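(* For every instance of the CBPP, the lower bounds provided by the linear relaxations of the formulations $\mathrm{AF}_{\mathrm{ml}}$ and $\mathrm{AF}_{\mathrm{ca}}$ are the same; that is, the optimal values of the two linear relaxations are equal (with the convention that the value is $+\infty$ if the relaxation is infeasible).
   Context: Notation: $[k]=\{1,\dots,k\}$. An instance of the Colored Bin Packing Problem (CBPP) consists of an integer bin capacity $L>0$, an integer number of colors $Q\ge 2$, and a set $\mathcal{I}=[m]$ of items, each item $u$ having an integer length $l_u>0$, an integer demand $d_u>0$ and a color $c_u\in[Q]$; all (length, color) pairs are distinct in $\mathcal{I}$. Formulation $\mathrm{AF}_{\mathrm{ml}}$ (multilayered arc flow). The digraph has vertex set $\{(0,0)\}\cup\{(j,q):1\le j\le L,\ q\in[Q]\}$ and arc set $A^{\mathrm{ml}}$ consisting of: source arcs $((0,0),(j,q))$ such that some $u\in\mathcal{I}$ has $l_u=j$, $c_u=q$; item arcs $((i,q),(j,q'))$ with $q\neq q'$ such that some $u\in\mathcal{I}$ has $l_u=j-i$, $c_u=q'$; and loss arcs $((i,q),(L,q))$ for $q\in[Q]$, $1\le i\le L-1$. The variables are $z$ and $x_{iqjq'}$ for $((i,q),(j,q'))\in A^{\mathrm{ml}}$, all nonnegative integers; minimize $z$ subject to: (Flow) the total flow leaving $(0,0)$ is $z$; at every vertex $(j,q)$ with $1\le j\le L-1$, $q\in[Q]$, inflow equals outflow; the total inflow into all sinks $(L,q)$, $q\in[Q]$, is $z$; (Demand) for every $u\in\mathcal{I}$, $\sum_{((i,q'),(j,q))\in A^{\mathrm{ml}}:\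 j=i+l_u,\ q=c_u,\ q'\ne q}x_{iq'jq}=d_u$. Formulation $\mathrm{AF}_{\mathrm{ca}}$ (color-alternating arc flow). The directed multigraph has $V=\{0,1,\dots,L\}$ and color-labeled arcs $A=A_1\cup\dots\cup A_{Q+1}$, where for $q\in[Q]$, $A_q=\{(i,j,q):0\le i\le j\le L,\ \exists u\in\mathcal{I}: l_u=j-i,\ c_u=q\}$, and $A_{Q+1}=\{(i,L,Q+1):1\le i\le L-1\}$ (loss-arcs). The variables are $z$ and $x_{ijq}$ for $(i,j,q)\in A$, all nonnegative integers; minimize $z$ subject to: (Flow) for every $j\in V$, $\sum_{(i,j,q)\in A}x_{ijq}-\sum_{(j,k,q')\in A}x_{jkq'}$ (all arcs entering, resp. leaving, $j$) equals $-z$ if $j=0$, $0$ if $1\le j\le L-1$, and $z$ if $j=L$; (Color) for every $j\in\{1,\dots,L-1\}$ and every fixed $q\in[Q]$, $\sum_{i:(i,j,q)\in A}x_{ijq}\le\sum_{(j,k,q')\in A,\ q'\in[Q+1]\setminus\{q\}}x_{jkq'}$; (Demand) for every $u\in\mathcal{I}$, $\sum_{(i,j,q)\in A:\ j=i+l_u,\ q=c_u}x_{ijq}=d_u$. In both formulations empty sums are $0$. The linear relaxation replaces "nonnegative integers" by "nonnegative reals" for all variables. *)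

theory Defs
  imports "HOL-Library.Extended_Real"
begin

section \<open>Instances of the colored bin packing problem\<close>

text \<open>Items are the numbers \<open>1, \<dots>, num_items\<close>; colors are the numbers \<open>1, \<dots>, num_colors\<close>.\<close>

record cbpp =
  capacity :: nat
  num_colors :: nat
  num_items :: nat
  item_length :: "nat \<Rightarrow> nat"
  item_demand :: "nat \<Rightarrow> nat"
  item_color :: "nat \<Rightarrow> nat"

definition items :: "cbpp \<Rightarrow> nat set" where
  "items I = {1..num_items I}"

definition colors :: "cbpp \<Rightarrow> nat set" where
  "colors I = {1..num_colors I}"

definition cbpp_instance :: "cbpp \<Rightarrow> bool" where
  "cbpp_instance I \<longleftrightarrow>
     capacity I > 0 \<and> num_colors I \<ge> 2 \<and>
     (\<forall>u\<in>items I. item_length I u > 0 \<and> item_demand I u > 0 \<and> item_color I u \<in> colors I) \<and>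
     inj_on (\<lambda>u. (item_length I u, item_color I u)) (items I)"

text \<open>
  In both formulations below, the parameter \<open>D\<close> is the domain of all the variables: \<open>D = \<nat>\<close>
  is the integer program, and \<open>D = {0..}\<close> is its linear relaxation. Variables are total
  functions, but only their values on arcs are ever constrained or used.
\<close>

section \<open>The multilayered arc flow formulation\<close>

type_synonym ml_vertex = "nat \<times> nat"
type_synonym ml_arc = "ml_vertex \<times> ml_vertex"

definition ml_source_arcs :: "cbpp \<Rightarrow> ml_arc set" where
  "ml_source_arcs I = {((0, 0), (j, q)) | j q.
     1 \<le> j \<and> j \<le> capacity I \<and> q \<in> colors I \<and>
     (\<exists>u\<in>items I. item_length I u = j \<and> item_color I u = q)}"

definition ml_item_arcs :: "cbpp \<Rightarrow> ml_arc set" where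
  "ml_item_arcs I = {((i, q), (j, q')) | i q j q'.
     1 \<le> i \<and> i \<le> capacity I \<and> q \<in> colors I \<and>
     1 \<le> j \<and> j \<le> capacity I \<and> q' \<in> colors I \<and> q \<noteq> q' \<and>
     (\<exists>u\<in>items I. j = i + item_length I u \<and> item_color I u = q')}"

definition ml_loss_arcs :: "cbpp \<Rightarrow> ml_arc set" where
  "ml_loss_arcs I = {((i, q), (capacity I, q)) | i q.
     q \<in> colors I \<and> 1 \<le> i \<and> i < capacity I}"

definition ml_arcs :: "cbpp \<Rightarrow> ml_arc set" where
  "ml_arcs I = ml_source_arcs I \<union> ml_item_arcs I \<union> ml_loss_arcs I"

definition ml_outflow :: "cbpp \<Rightarrow> (ml_arc \<Rightarrow> real) \<Rightarrow> ml_vertex \<Rightarrow> real" where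
  "ml_outflow I x v = (\<Sum>a\<in>{a \<in> ml_arcs I. fst a = v}. x a)"

definition ml_inflow :: "cbpp \<Rightarrow> (ml_arc \<Rightarrow> real) \<Rightarrow> ml_vertex \<Rightarrow> real" where
  "ml_inflow I x v = (\<Sum>a\<in>{a \<in> ml_arcs I. snd a = v}. x a)"

definition ml_feasible :: "real set \<Rightarrow> cbpp \<Rightarrow> real \<Rightarrow> (ml_arc \<Rightarrow> real) \<Rightarrow> bool" where
  "ml_feasible D I z x \<longleftrightarrow>
     z \<in> D \<and> (\<forall>a\<in>ml_arcs I. x a \<in> D) \<and>
     ml_outflow I x (0, 0) = z \<and>
     (\<forall>j\<in>{1..<capacity I}. \<forall>q\<in>colors I. ml_inflow I x (j, q) = ml_outflow I x (j, q)) \<and>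
     (\<Sum>q\<in>colors I. ml_inflow I x (capacity I, q)) = z \<and>
     (\<forall>u\<in>items I.
        (\<Sum>a\<in>{((i, q'), (j, q)) \<in> ml_arcs I.
               j = i + item_length I u \<and> q = item_color I u \<and> q' \<noteq> q}. x a)
        = real (item_demand I u))"

definition ml_value :: "real set \<Rightarrow> cbpp \<Rightarrow> ereal" where
  "ml_value D I = Inf {ereal z | z. \<exists>x. ml_feasible D I z x}"

section \<open>The color-alternating arc flow formulation\<close>

type_synonym ca_arc = "nat \<times> nat \<times> nat"

definition ca_item_arcs :: "cbpp \<Rightarrow> nat \<Rightarrow> ca_arc set" where
  "ca_item_arcs I q = {(i, j, q) | i j.
     i \<le> j \<and> j \<le> capacity I \<and>
     (\<exists>u\<in>items I. j = i + item_length I u \<and> item_color I u = q)}"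

definition ca_loss_arcs :: "cbpp \<Rightarrow> ca_arc set" where
  "ca_loss_arcs I = {(i, capacity I, num_colors I + 1) | i. 1 \<le> i \<and> i < capacity I}"

definition ca_arcs :: "cbpp \<Rightarrow> ca_arc set" where
  "ca_arcs I = (\<Union>q\<in>colors I. ca_item_arcs I q) \<union> ca_loss_arcs I"

definition ca_inflow :: "cbpp \<Rightarrow> (ca_arc \<Rightarrow> real) \<Rightarrow> nat \<Rightarrow> real" where
  "ca_inflow I x v = (\<Sum>a\<in>{(i, j, q) \<in> ca_arcs I. j = v}. x a)"

definition ca_outflow :: "cbpp \<Rightarrow> (ca_arc \<Rightarrow> real) \<Rightarrow> nat \<Rightarrow> real" where
  "ca_outflow I x v = (\<Sum>a\<in>{(i, j, q) \<in> ca_arcs I. i = v}. x a)"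

definition ca_feasible :: "real set \<Rightarrow> cbpp \<Rightarrow> real \<Rightarrow> (ca_arc \<Rightarrow> real) \<Rightarrow> bool" where
  "ca_feasible D I z x \<longleftrightarrow>
     z \<in> D \<and> (\<forall>a\<in>ca_arcs I. x a \<in> D) \<and>
     (\<forall>j\<in>{0..capacity I}. ca_inflow I x j - ca_outflow I x j =
        (if j = 0 then - z else if j = capacity I then z else 0)) \<and>
     (\<forall>v\<in>{1..<capacity I}. \<forall>c\<in>colors I.
        (\<Sum>a\<in>{(i, j, q) \<in> ca_arcs I. j = v \<and> q = c}. x a)
        \<le> (\<Sum>a\<in>{(j, k, q') \<in> ca_arcs I. j = v \<and> q' \<in> {1..num_colors I + 1} - {c}}. x a)) \<and>
     (\<forall>u\<in>items I.
        (\<Sum>a\<in>{(i, j, q) \<in> ca_arcs I. j = i + item_length I u \<and> q = item_color I u}. x a)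
        = real (item_demand I u))"

definition ca_value :: "real set \<Rightarrow> cbpp \<Rightarrow> ereal" where
  "ca_value D I = Inf {ereal z | z. \<exists>x. ca_feasible D I z x}"

section \<open>The linear relaxations\<close>

text \<open>The infimum of the empty set in \<^typ>\<open>ereal\<close> is \<open>\<infinity>\<close>, the value of an infeasible program.\<close>

definition ml_lp_bound :: "cbpp \<Rightarrow> ereal" where
  "ml_lp_bound I = ml_value {0..} I"

definition ca_lp_bound :: "cbpp \<Rightarrow> ereal" where
  "ca_lp_bound I = ca_value {0..} I"

text \<open>The arc sets are finite, so none of the sums above defaults to \<open>0\<close>.\<close>

lemma finite_ml_arcs: "finite (ml_arcs I)"
proof (rule finite_subset)
  show "ml_arcs I \<subseteq> (({0..capacity I} \<times> {0..num_colors I}) \<times> ({0..capacity I} \<times> {0..num_colors I}))"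
    by (auto simp: ml_arcs_def ml_source_arcs_def ml_item_arcs_def ml_loss_arcs_def colors_def)
qed simp

lemma finite_ca_arcs: "finite (ca_arcs I)"
proof (rule finite_subset)
  show "ca_arcs I \<subseteq> {0..capacity I} \<times> {0..capacity I} \<times> {0..num_colors I + 1}"
    by (auto simp: ca_arcs_def ca_item_arcs_def ca_loss_arcs_def colors_def)
qed simp

end

theory Submission
  imports Defs
begin

text \<open>
  Forgetting the color of the tail of an arc maps the arcs of the multilayered network onto those
  of the color-alternating one (loss arcs get the color \<open>Q + 1\<close>). Pushing a multilayered flow
  forward along this map gives a color-alternating flow of the same value, because the flow leaving
  \<open>(j, q)\<close> uses no item arc of color \<open>q\<close>. Conversely, a color-alternating flow is lifted by deciding,
  at each vertex \<open>j\<close>, how much of the inflow of color \<open>c\<close> continues on arcs of color \<open>k\<close>. Such a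
  decision is a nonnegative matrix with prescribed row and column sums and zero diagonal, and the
  color constraints are exactly the condition for such a matrix to exist.
\<close>

section \<open>Transportation matrices with zero diagonal\<close>

text \<open>For \<open>p \<le> q\<close> and \<open>u \<le> v\<close> this is the length of the
  intersection of \<open>[p, q]\<close> and \<open>[u, v]\<close>. As an increment of the projection
  onto \<open>[p, q]\<close>, it telescopes over consecutive intervals.\<close>

definition overlap :: "real \<Rightarrow> real \<Rightarrow> real \<Rightarrow> real \<Rightarrow> real" where
  "overlap p q u v = max p (min q v) - max p (min q u)"

lemma overlap_commute: "p \<le> q \<Longrightarrow> u \<le> v \<Longrightarrow> overlap p q u v = overlap u v p q"
  unfolding overlap_def by (simp add: max_def min_def)

lemma overlap_nonneg: "u \<le> v \<Longrightarrow> 0 \<le> overlap p q u v"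
  unfolding overlap_def by (simp add: max_def min_def)

lemma overlap_shift: "overlap p q (u - s) (v - s) = overlap (p + s) (q + s) u v"
  unfolding overlap_def by (simp add: max_def min_def)

lemma overlap_trans: "overlap p q u v + overlap p q v w = overlap p q u w"
  unfolding overlap_def by simp

lemma overlap_superset: "p \<le> q \<Longrightarrow> u \<le> p \<Longrightarrow> q \<le> v \<Longrightarrow> overlap p q u v = q - p"
  unfolding overlap_def by simp

lemma overlap_disjoint: "p \<le> q \<Longrightarrow> u \<le> v \<Longrightarrow> q \<le> u \<or> v \<le> p \<Longrightarrow> overlap p q u v = 0"
  unfolding overlap_def by (auto simp: max_def min_def)

lemma sum_overlap:
  "(\<Sum>k<n. overlap p q (f k) (f (Suc k))) = overlap p q (f 0) (f n)"
  unfolding overlap_def by (simp add: sum_lessThan_telescope[of "\<lambda>k. max p (min q (f k))"])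

text \<open>
  Cut a circle of circumference \<open>S\<close> into consecutive arcs of lengths \<open>a 0, a 1, \<dots>\<close> and a second time
  into consecutive arcs of lengths \<open>b 0, b 1, \<dots>\<close>, the second subdivision being rotated by \<open>s\<close>.
  Entry \<open>(i, j)\<close> of the matrix is the length of the intersection of the \<open>i\<close>-th arc of the first
  subdivision with the \<open>j\<close>-th arc of the second one. The \<open>k\<close>-th arcs are disjoint for all \<open>k\<close>
  if \<open>s\<close> lies between \<open>A (k + 1) - B k\<close> and \<open>S + A k - B (k + 1)\<close>, where \<open>A\<close> and \<open>B\<close> are the
  partial sums; the hypotheses say that all these intervals for \<open>s\<close> meet.
\<close>

lemma zero_diagonal_transport_lessThan:
  fixes a b :: "nat \<Rightarrow> real"
  assumes a: "\<And>k. k < n \<Longrightarrow> 0 \<le> a k" and b: "\<And>k. k < n \<Longrightarrow> 0 \<le> b k"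
    and eq: "sum a {..<n} = sum b {..<n}"
    and le: "\<And>k. k < n \<Longrightarrow> a k + b k \<le> sum b {..<n}"
  shows "\<exists>t. (\<forall>i<n. \<forall>j<n. 0 \<le> t i j) \<and> (\<forall>k<n. t k k = (0::real)) \<and>
    (\<forall>i<n. (\<Sum>j<n. t i j) = a i) \<and> (\<forall>j<n. (\<Sum>i<n. t i j) = b j)"
proof (cases "n = 0")
  case False
  define S where "S = sum b {..<n}"
  define A where "A k = sum a {..<k}" for k
  define B where "B k = sum b {..<k}" for k
  define s where "s = Max ((\<lambda>k. A (Suc k) - B k) ` {..<n})"
  have A_mono: "A k \<le> A l" if "k \<le> l" "l \<le> n" for k l
    unfolding A_def using that a by (intro sum_mono2) auto
  have B_mono: "B k \<le> B l" if "k \<le> l" "l \<le> n" for k l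
    unfolding B_def using that b by (intro sum_mono2) auto
  have ends: "A 0 = 0" "B 0 = 0" "A n = S" "B n = S"
    using eq by (auto simp: A_def B_def S_def)
  have Suc: "A (Suc k) = A k + a k" "B (Suc k) = B k + b k" for k
    by (auto simp: A_def B_def)
  have s_lower: "A (Suc k) - B k \<le> s" if "k < n" for k
    unfolding s_def using that by (intro Max_ge) auto
  \<comment> \<open>Every left end, with index \<open>c\<close>, must lie below every right end,
    with index \<open>d\<close>. For \<open>c = d\<close> this is the hypothesis \<open>le\<close>;
    otherwise monotonicity of \<open>A\<close> and \<open>B\<close> suffices.\<close>
  have s_upper: "s \<le> S + A d - B (Suc d)" if d: "d < n" for d
  proof -
    have "A (Suc c) - B c \<le> S + A d - B (Suc d)" if c: "c < n" for c
    proof -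
      consider "c = d" | "Suc c \<le> d" | "Suc d \<le> c" by linarith
      then show ?thesis
      proof cases
        case 1
        then show ?thesis using le[OF d] by (simp add: Suc S_def)
      next
        case 2
        then show ?thesis using A_mono[of "Suc c" d] B_mono[of "Suc d" n] B_mono[of 0 c] c d ends
          by simp
      next
        case 3
        then show ?thesis using B_mono[of "Suc d" c] A_mono[of "Suc c" n] A_mono[of 0 d] c d ends
          by simp
      qed
    qed
    then show ?thesis unfolding s_def using False by (subst Max_le_iff) auto
  qed
  have s0: "0 \<le> s" using s_lower[of 0] A_mono[of 0 1] ends False by simp
  have sS: "s \<le> S" using s_upper[of 0] B_mono[of 0 1] ends False by simp
  \<comment> \<open>The circle is the interval \<open>[0, S]\<close>. As
    \<open>0 \<le> s \<le> S\<close>, the rotated arcs lie in \<open>[0, 2 * S]\<close>; the second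
    summand catches the part that wraps around.\<close>
  define t where "t i j = overlap (A i) (A (Suc i)) (B j + s) (B (Suc j) + s)
    + overlap (A i) (A (Suc i)) (B j + s - S) (B (Suc j) + s - S)" for i j
  have "0 \<le> t i j" if "i < n" "j < n" for i j
    unfolding t_def using that B_mono[of j "Suc j"] by (intro add_nonneg_nonneg overlap_nonneg) auto
  \<comment> \<open>By \<open>s_lower\<close> the \<open>k\<close>-th arc of the first subdivision
    ends before the first copy of the rotated arc begins; by \<open>s_upper\<close> it starts after
    the second copy ends.\<close>
  moreover have "t k k = 0" if "k < n" for k
    using s_lower[OF that] s_upper[OF that] A_mono[of k "Suc k"] B_mono[of k "Suc k"] that
    unfolding t_def by (simp add: overlap_disjoint)
  moreover have "(\<Sum>j<n. t i j) = a i" if "i < n" for i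
  proof -
    have "(\<Sum>j<n. t i j) = overlap (A i) (A (Suc i)) s (S + s) + overlap (A i) (A (Suc i)) (s - S) s"
      unfolding t_def sum.distrib
      using sum_overlap[of "A i" "A (Suc i)" "\<lambda>k. B k + s" n]
        sum_overlap[of "A i" "A (Suc i)" "\<lambda>k. B k + s - S" n] by (simp add: ends)
    \<comment> \<open>The two copies of the second subdivision tile \<open>[s - S, S + s]\<close>,
      which contains \<open>[0, S]\<close>.\<close>
    also have "\<dots> = overlap (A i) (A (Suc i)) (s - S) (S + s)"
      by (metis overlap_trans add.commute)
    also have "\<dots> = a i"
      using that A_mono[of i "Suc i"] A_mono[of 0 i] A_mono[of "Suc i" n] s0 sS
      by (subst overlap_superset) (auto simp: ends Suc)
    finally show ?thesis .
  qed
  moreover have "(\<Sum>i<n. t i j) = b j" if "j < n" for j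
  proof -
    let ?u = "B j + s" and ?v = "B (Suc j) + s"
    have uv: "?u \<le> ?v" using B_mono[of j "Suc j"] that by simp
    have "(\<Sum>i<n. t i j) = (\<Sum>i<n. overlap ?u ?v (A i) (A (Suc i))
        + overlap (?u - S) (?v - S) (A i) (A (Suc i)))"
      unfolding t_def using A_mono uv by (intro sum.cong) (auto simp: overlap_commute)
    also have "\<dots> = overlap ?u ?v 0 S + overlap (?u - S) (?v - S) 0 S"
      by (simp add: sum.distrib sum_overlap ends)
    \<comment> \<open>Instead of moving the arc back by \<open>S\<close>, move the circle forward:
      two adjacent copies of it cover the whole rotated arc.\<close>
    also have "overlap (?u - S) (?v - S) 0 S = overlap ?u ?v S (2 * S)"
      using overlap_shift[of "?u - S" "?v - S" S S "2 * S"] by simp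
    also have "overlap ?u ?v 0 S + overlap ?u ?v S (2 * S) = b j"
      using that B_mono[of 0 j] B_mono[of "Suc j" n] s0 sS uv
      unfolding overlap_trans by (subst overlap_superset) (auto simp: ends Suc)
    finally show ?thesis .
  qed
  ultimately show ?thesis by blast
qed simp

text \<open>The circle argument needs the indices in a linear order; an enumeration of
  \<open>K\<close> provides one, and the matrix is carried back along it.\<close>

lemma zero_diagonal_transport:
  fixes a b :: "'a \<Rightarrow> real"
  assumes "finite K" and a: "\<And>k. k \<in> K \<Longrightarrow> 0 \<le> a k" and b: "\<And>k. k \<in> K \<Longrightarrow> 0 \<le> b k"
    and eq: "sum a K = sum b K" and le: "\<And>k. k \<in> K \<Longrightarrow> a k + b k \<le> sum b K"
  shows "\<exists>t. (\<forall>i\<in>K. \<forall>j\<in>K. 0 \<le> t i j) \<and> (\<forall>k\<in>K. t k k = (0::real)) \<and>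
    (\<forall>i\<in>K. (\<Sum>j\<in>K. t i j) = a i) \<and> (\<forall>j\<in>K. (\<Sum>i\<in>K. t i j) = b j)"
proof -
  obtain h where h: "bij_betw h K {..<card K}"
    using ex_bij_betw_finite_nat[OF \<open>finite K\<close>] by (auto simp: atLeast0LessThan)
  define g where "g = inv_into K h"
  have g: "bij_betw g {..<card K} K"
    unfolding g_def by (rule bij_betw_inv_into[OF h])
  have gh: "g (h k) = k" if "k \<in> K" for k
    unfolding g_def by (rule bij_betw_inv_into_left[OF h that])
  have gK: "g k \<in> K" if "k < card K" for k
    using bij_betwE[OF g] that by auto
  have hK: "h k < card K" if "k \<in> K" for k
    using bij_betwE[OF h] that by auto
  have sum_g: "(\<Sum>k<card K. f (g k)) = sum f K" for f :: "'a \<Rightarrow> real"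
    by (rule sum.reindex_bij_betw[OF g])
  have sum_h: "(\<Sum>k\<in>K. f (h k)) = sum f {..<card K}" for f :: "nat \<Rightarrow> real"
    by (rule sum.reindex_bij_betw[OF h])
  obtain t where t: "\<forall>i<card K. \<forall>j<card K. 0 \<le> t i j" "\<forall>k<card K. t k k = (0::real)"
    "\<forall>i<card K. (\<Sum>j<card K. t i j) = a (g i)" "\<forall>j<card K. (\<Sum>i<card K. t i j) = b (g j)"
    using zero_diagonal_transport_lessThan[of "card K" "\<lambda>k. a (g k)" "\<lambda>k. b (g k)"]
      a b le eq gK unfolding sum_g by auto
  show ?thesis
    using t by (intro exI[of _ "\<lambda>i j. t (h i) (h j)"]) (simp add: hK gh sum_h sum_h[of "\<lambda>i. t i (h j)" for j])
qed

section \<open>Collapsing the layers\<close>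

text \<open>Equal layers single out the loss arcs: item arcs change the color, and the layer
  \<open>0\<close> of the source is not a color.\<close>

fun collapse :: "cbpp \<Rightarrow> ml_arc \<Rightarrow> ca_arc" where
  "collapse I ((i, p), (j, q)) = (i, j, if p = q then num_colors I + 1 else q)"

text \<open>The image reveals the type of an arc: the label \<open>num_colors I + 1\<close> belongs
  to loss arcs and the tail \<open>0\<close> to source arcs. Fibres and images of
  \<open>collapse\<close> are computed from this.\<close>

lemma ml_arcs_iff:
  assumes "cbpp_instance I"
  shows "((i, p), (j, q)) \<in> ml_arcs I \<longleftrightarrow>
    q \<in> colors I \<and> (if i = 0 then p = 0 else p \<in> colors I) \<and> collapse I ((i, p), (j, q)) \<in> ca_arcs I"
  using assms
  by (auto simp: cbpp_instance_def ml_arcs_def ml_source_arcs_def ml_item_arcs_def ml_loss_arcs_def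
      ca_arcs_def ca_item_arcs_def ca_loss_arcs_def colors_def)

lemma ca_arcsD:
  assumes "cbpp_instance I" and "(i, j, k) \<in> ca_arcs I"
  shows "i < j" "j \<le> capacity I" "k \<in> {1..num_colors I + 1}"
    "k = num_colors I + 1 \<Longrightarrow> j = capacity I \<and> 1 \<le> i"
  using assms
  by (auto simp: cbpp_instance_def ca_arcs_def ca_item_arcs_def ca_loss_arcs_def colors_def)

definition pushforward :: "cbpp \<Rightarrow> (ml_arc \<Rightarrow> real) \<Rightarrow> ca_arc \<Rightarrow> real" where
  "pushforward I x b = (\<Sum>a\<in>{a \<in> ml_arcs I. collapse I a = b}. x a)"

text \<open>Group the layered arcs by their images. Since \<open>y\<close> only has to agree with
  the pushforward on arcs, this serves both directions: \<open>y\<close> may be the pushforward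
  itself, or a given flow with lift \<open>x\<close>.\<close>

lemma sum_pushforward:
  assumes "cbpp_instance I" and y: "\<And>b. b \<in> ca_arcs I \<Longrightarrow> y b = pushforward I x b"
  shows "(\<Sum>b\<in>{b \<in> ca_arcs I. P b}. y b) = (\<Sum>a\<in>{a \<in> ml_arcs I. P (collapse I a)}. x a)"
proof -
  have "(\<Sum>b\<in>{b \<in> ca_arcs I. P b}. y b) =
      (\<Sum>b\<in>{b \<in> ca_arcs I. P b}. \<Sum>a\<in>{a \<in> {a \<in> ml_arcs I. P (collapse I a)}. collapse I a = b}. x a)"
    by (intro sum.cong refl) (auto simp: y pushforward_def intro!: sum.cong)
  also have "\<dots> = (\<Sum>a\<in>{a \<in> ml_arcs I. P (collapse I a)}. x a)"
    using ml_arcs_iff[OF assms(1)]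
    by (intro sum.group) (auto simp: finite_ml_arcs finite_ca_arcs)
  finally show ?thesis .
qed

definition ca_inflow_color :: "cbpp \<Rightarrow> (ca_arc \<Rightarrow> real) \<Rightarrow> nat \<Rightarrow> nat \<Rightarrow> real" where
  "ca_inflow_color I y v c = (\<Sum>a\<in>{a \<in> ca_arcs I. fst (snd a) = v \<and> snd (snd a) = c}. y a)"

definition ca_outflow_color :: "cbpp \<Rightarrow> (ca_arc \<Rightarrow> real) \<Rightarrow> nat \<Rightarrow> nat \<Rightarrow> real" where
  "ca_outflow_color I y v c = (\<Sum>a\<in>{a \<in> ca_arcs I. fst a = v \<and> snd (snd a) = c}. y a)"

lemma ca_inflow_alt: "ca_inflow I y v = (\<Sum>a\<in>{a \<in> ca_arcs I. fst (snd a) = v}. y a)"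
  unfolding ca_inflow_def by (intro sum.cong) auto

lemma ca_outflow_alt: "ca_outflow I y v = (\<Sum>a\<in>{a \<in> ca_arcs I. fst a = v}. y a)"
  unfolding ca_outflow_def by (intro sum.cong) auto

lemma ca_inflow_eq_sum_colors:
  assumes "cbpp_instance I"
  shows "ca_inflow I y v = (\<Sum>c\<in>{1..num_colors I + 1}. ca_inflow_color I y v c)"
proof -
  have "(\<Sum>c\<in>{1..num_colors I + 1}.
      \<Sum>a\<in>{a \<in> {a \<in> ca_arcs I. fst (snd a) = v}. snd (snd a) = c}. y a) = ca_inflow I y v"
    unfolding ca_inflow_alt using ca_arcsD(3)[OF assms]
    by (intro sum.group) (auto simp: finite_ca_arcs)
  then show ?thesis unfolding ca_inflow_color_def by (simp add: conj_assoc)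
qed

lemma ca_outflow_eq_sum_colors:
  assumes "cbpp_instance I"
  shows "ca_outflow I y v = (\<Sum>c\<in>{1..num_colors I + 1}. ca_outflow_color I y v c)"
proof -
  have "(\<Sum>c\<in>{1..num_colors I + 1}.
      \<Sum>a\<in>{a \<in> {a \<in> ca_arcs I. fst a = v}. snd (snd a) = c}. y a) = ca_outflow I y v"
    unfolding ca_outflow_alt using ca_arcsD(3)[OF assms]
    by (intro sum.group) (auto simp: finite_ca_arcs)
  then show ?thesis unfolding ca_outflow_color_def by (simp add: conj_assoc)
qed

lemma ca_inflow_0: "cbpp_instance I \<Longrightarrow> ca_inflow I y 0 = 0"
  unfolding ca_inflow_alt using ca_arcsD(1) by (intro sum.neutral) fastforce

lemma ca_outflow_capacity: "cbpp_instance I \<Longrightarrow> ca_outflow I y (capacity I) = 0"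
  unfolding ca_outflow_alt using ca_arcsD(1,2) by (intro sum.neutral) fastforce

context
  fixes I x y
  assumes inst: "cbpp_instance I" and push: "\<And>b. b \<in> ca_arcs I \<Longrightarrow> y b = pushforward I x b"
begin

lemma ca_inflow_pushforward:
  "ca_inflow I y v = (\<Sum>q\<in>colors I. ml_inflow I x (v, q))"
proof -
  let ?A = "{a \<in> ml_arcs I. fst (snd a) = v}"
  have "ca_inflow I y v = (\<Sum>a\<in>{a \<in> ml_arcs I. fst (snd (collapse I a)) = v}. x a)"
    unfolding ca_inflow_alt by (rule sum_pushforward[OF inst push])
  also have "{a \<in> ml_arcs I. fst (snd (collapse I a)) = v} = ?A" by auto
  also have "sum x ?A = (\<Sum>q\<in>colors I. \<Sum>a\<in>{a \<in> ?A. snd (snd a) = q}. x a)"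
    using ml_arcs_iff[OF inst] by (intro sum.group[symmetric]) (auto simp: finite_ml_arcs colors_def)
  also have "\<dots> = (\<Sum>q\<in>colors I. ml_inflow I x (v, q))"
    unfolding ml_inflow_def by (intro sum.cong) auto
  finally show ?thesis .
qed

lemma ca_outflow_pushforward:
  assumes "1 \<le> v"
  shows "ca_outflow I y v = (\<Sum>q\<in>colors I. ml_outflow I x (v, q))"
proof -
  let ?A = "{a \<in> ml_arcs I. fst (fst a) = v}"
  have "ca_outflow I y v = (\<Sum>a\<in>{a \<in> ml_arcs I. fst (collapse I a) = v}. x a)"
    unfolding ca_outflow_alt by (rule sum_pushforward[OF inst push])
  also have "{a \<in> ml_arcs I. fst (collapse I a) = v} = ?A" by auto
  also have "sum x ?A = (\<Sum>q\<in>colors I. \<Sum>a\<in>{a \<in> ?A. snd (fst a) = q}. x a)"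
    using ml_arcs_iff[OF inst] assms
    by (intro sum.group[symmetric]) (auto simp: finite_ml_arcs colors_def)
  also have "\<dots> = (\<Sum>q\<in>colors I. ml_outflow I x (v, q))"
    unfolding ml_outflow_def by (intro sum.cong) auto
  finally show ?thesis .
qed

lemma ca_outflow_0_pushforward: "ca_outflow I y 0 = ml_outflow I x (0, 0)"
proof -
  have "ca_outflow I y 0 = (\<Sum>a\<in>{a \<in> ml_arcs I. fst (collapse I a) = 0}. x a)"
    unfolding ca_outflow_alt by (rule sum_pushforward[OF inst push])
  also have "{a \<in> ml_arcs I. fst (collapse I a) = 0} = {a \<in> ml_arcs I. fst a = (0, 0)}"
    using ml_arcs_iff[OF inst] by auto
  finally show ?thesis unfolding ml_outflow_def .
qed

text \<open>Loss arcs end at the capacity, so every arc entering \<open>v\<close> is labelled by the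
  layer of its head.\<close>

lemma ca_inflow_color_pushforward:
  assumes "v < capacity I" "c \<in> colors I"
  shows "ca_inflow_color I y v c = ml_inflow I x (v, c)"
proof -
  have "ca_inflow_color I y v c =
      (\<Sum>a\<in>{a \<in> ml_arcs I. fst (snd (collapse I a)) = v \<and> snd (snd (collapse I a)) = c}. x a)"
    unfolding ca_inflow_color_def by (rule sum_pushforward[OF inst push])
  also have "{a \<in> ml_arcs I. fst (snd (collapse I a)) = v \<and> snd (snd (collapse I a)) = c}
      = {a \<in> ml_arcs I. snd a = (v, c)}"
    using assms ca_arcsD(4)[OF inst] by (auto simp: ml_arcs_iff[OF inst] colors_def split: if_splits)
  finally show ?thesis unfolding ml_inflow_def .
qed

text \<open>An arc leaving layer \<open>c\<close> either changes the color or is a loss arc, so its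
  image never has label \<open>c\<close>. Together with flow conservation this yields the color
  constraint.\<close>

lemma ml_outflow_le_pushforward:
  assumes nonneg: "\<And>a. a \<in> ml_arcs I \<Longrightarrow> 0 \<le> x a" and c: "c \<in> colors I"
  shows "ml_outflow I x (v, c) \<le> (\<Sum>a\<in>{a \<in> ca_arcs I. fst a = v \<and> snd (snd a) \<noteq> c}. y a)"
proof -
  have "{a \<in> ml_arcs I. fst a = (v, c)}
      \<subseteq> {a \<in> ml_arcs I. fst (collapse I a) = v \<and> snd (snd (collapse I a)) \<noteq> c}"
    using c by (auto simp: colors_def split: if_splits)
  then have "ml_outflow I x (v, c)
      \<le> (\<Sum>a\<in>{a \<in> ml_arcs I. fst (collapse I a) = v \<and> snd (snd (collapse I a)) \<noteq> c}. x a)"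
    unfolding ml_outflow_def using nonneg by (intro sum_mono2) (auto simp: finite_ml_arcs)
  also have "\<dots> = (\<Sum>a\<in>{a \<in> ca_arcs I. fst a = v \<and> snd (snd a) \<noteq> c}. y a)"
    by (rule sum_pushforward[OF inst push, symmetric])
  finally show ?thesis .
qed

text \<open>A loss arc can match the length and head color of an item. It is excluded by
  \<open>q' \<noteq> q\<close> on the layered side and by its label on the other.\<close>

lemma demand_pushforward:
  assumes "u \<in> items I"
  shows "(\<Sum>a\<in>{(i, j, q) \<in> ca_arcs I. j = i + item_length I u \<and> q = item_color I u}. y a) =
    (\<Sum>a\<in>{((i, q'), (j, q)) \<in> ml_arcs I. j = i + item_length I u \<and> q = item_color I u \<and> q' \<noteq> q}. x a)"
    (is "sum y ?B = sum x ?A")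
proof -
  let ?P = "\<lambda>(i, j, q). j = i + item_length I u \<and> q = item_color I u"
  have "item_color I u \<in> colors I" using inst assms by (simp add: cbpp_instance_def)
  then have "?A = {a \<in> ml_arcs I. ?P (collapse I a)}"
    by (auto simp: colors_def split: if_splits)
  moreover have "?B = {b \<in> ca_arcs I. ?P b}" by auto
  ultimately show ?thesis using sum_pushforward[OF inst push, of ?P] by simp
qed

end

lemma ca_color_constraint_alt:
  assumes "cbpp_instance I"
  shows "(\<Sum>a\<in>{(i, j, q) \<in> ca_arcs I. j = v \<and> q = c}. y a) = ca_inflow_color I y v c"
    and "(\<Sum>a\<in>{(j, k, q') \<in> ca_arcs I. j = v \<and> q' \<in> {1..num_colors I + 1} - {c}}. y a)
      = (\<Sum>a\<in>{a \<in> ca_arcs I. fst a = v \<and> snd (snd a) \<noteq> c}. y a)"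
  unfolding ca_inflow_color_def using ca_arcsD(3)[OF assms] by (auto intro!: sum.cong)

lemma ca_feasible_pushforward:
  assumes inst: "cbpp_instance I" and x: "ml_feasible {0..} I z x"
  shows "ca_feasible {0..} I z (pushforward I x)"
proof -
  note [simp] = ca_inflow_pushforward[OF inst refl] ca_outflow_pushforward[OF inst refl]
    demand_pushforward[OF inst refl] ca_inflow_color_pushforward[OF inst refl]
  have nonneg: "0 \<le> x a" if "a \<in> ml_arcs I" for a using x that by (auto simp: ml_feasible_def)
  have cap: "0 < capacity I" using inst by (simp add: cbpp_instance_def)
  have flow: "ml_inflow I x (j, q) = ml_outflow I x (j, q)"
    if "1 \<le> j" "j < capacity I" "q \<in> colors I" for j q
    using x that by (auto simp: ml_feasible_def)
  have "0 \<le> pushforward I x b" for b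
    unfolding pushforward_def using nonneg by (intro sum_nonneg) auto
  moreover have "ca_inflow I (pushforward I x) j - ca_outflow I (pushforward I x) j =
      (if j = 0 then - z else if j = capacity I then z else 0)" if j: "j \<le> capacity I" for j
  proof -
    consider "j = 0" | "j = capacity I" "0 < j" | "1 \<le> j" "j < capacity I" using j cap by linarith
    then show ?thesis
    proof cases
      case 1
      then show ?thesis
        using x ca_inflow_0[OF inst, of "pushforward I x"]
          ca_outflow_0_pushforward[OF inst refl, where x = x]
        by (simp add: ml_feasible_def del: ca_inflow_pushforward)
    next
      case 2
      then show ?thesis
        using x ca_outflow_capacity[OF inst, of "pushforward I x"] by (simp add: ml_feasible_def)
    next
      case 3
      then show ?thesis by (simp add: flow)
    qed
  qed
  moreover have "ca_inflow_color I (pushforward I x) v c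
      \<le> (\<Sum>a\<in>{a \<in> ca_arcs I. fst a = v \<and> snd (snd a) \<noteq> c}. pushforward I x a)"
    if "1 \<le> v" "v < capacity I" "c \<in> colors I" for v c
    using ml_outflow_le_pushforward[OF inst refl, where x = x and v = v and c = c] that nonneg
    by (simp add: flow)
  ultimately show ?thesis
    using x unfolding ca_feasible_def ml_feasible_def ca_color_constraint_alt[OF inst] by auto
qed

section \<open>Lifting a color-alternating flow\<close>

lemma ca_feasible_flow:
  assumes "ca_feasible D I z y" "j \<le> capacity I"
  shows "ca_inflow I y j - ca_outflow I y j =
    (if j = 0 then - z else if j = capacity I then z else 0)"
  using assms unfolding ca_feasible_def by simp

text \<open>\<open>t c k\<close> is the amount entering \<open>v\<close> with color \<open>c\<close>
  and leaving with label \<open>k\<close>. Adding the outflow of color \<open>c\<close> to both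
  sides of the color constraint gives the hypothesis of the transport lemma. No loss arc enters
  \<open>v\<close>, so the row of the loss label vanishes and the column sums need only range over
  the colors.\<close>

lemma ca_feasible_transport:
  assumes inst: "cbpp_instance I" and y: "ca_feasible {0..} I z y" and v: "1 \<le> v" "v < capacity I"
  shows "\<exists>t. (\<forall>c k. c \<in> {1..num_colors I + 1} \<longrightarrow> k \<in> {1..num_colors I + 1} \<longrightarrow> (0::real) \<le> t c k) \<and>
    (\<forall>c\<in>{1..num_colors I + 1}. t c c = 0) \<and>
    (\<forall>c\<in>{1..num_colors I + 1}. (\<Sum>k\<in>{1..num_colors I + 1}. t c k) = ca_inflow_color I y v c) \<and>
    (\<forall>k\<in>{1..num_colors I + 1}. (\<Sum>c\<in>colors I. t c k) = ca_outflow_color I y v k)"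
proof -
  let ?K = "{1..num_colors I + 1}"
  have nonneg: "0 \<le> y b" if "b \<in> ca_arcs I" for b using y that by (auto simp: ca_feasible_def)
  have in_nonneg: "0 \<le> ca_inflow_color I y v c" for c
    unfolding ca_inflow_color_def using nonneg by (intro sum_nonneg) auto
  have out_nonneg: "0 \<le> ca_outflow_color I y v c" for c
    unfolding ca_outflow_color_def using nonneg by (intro sum_nonneg) auto
  have no_loss: "ca_inflow_color I y v (num_colors I + 1) = 0"
    unfolding ca_inflow_color_def using ca_arcsD(4)[OF inst] v by (intro sum.neutral) fastforce
  have "ca_inflow_color I y v c + ca_outflow_color I y v c \<le> sum (ca_outflow_color I y v) ?K"
    if "c \<in> ?K" for c
  proof (cases "c = num_colors I + 1")
    case True
    then show ?thesis
      using no_loss member_le_sum[OF that, of "ca_outflow_color I y v"] out_nonneg by simp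
  next
    case False
    then have c: "c \<in> colors I" using that by (auto simp: colors_def)
    have "ca_inflow_color I y v c \<le> (\<Sum>a\<in>{a \<in> ca_arcs I. fst a = v \<and> snd (snd a) \<noteq> c}. y a)"
      using y v c unfolding ca_feasible_def ca_color_constraint_alt[OF inst] by auto
    moreover have "(\<Sum>a\<in>{a \<in> ca_arcs I. fst a = v \<and> snd (snd a) \<noteq> c}. y a)
        + ca_outflow_color I y v c = ca_outflow I y v"
      unfolding ca_outflow_alt ca_outflow_color_def
      by (subst sum.union_disjoint[symmetric]) (auto simp: finite_ca_arcs intro!: sum.cong)
    ultimately show ?thesis by (simp add: ca_outflow_eq_sum_colors[OF inst])
  qed
  moreover have "ca_inflow I y v = ca_outflow I y v"
    using ca_feasible_flow[OF y, of v] v by simp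
  then have "sum (ca_inflow_color I y v) ?K = sum (ca_outflow_color I y v) ?K"
    unfolding ca_inflow_eq_sum_colors[OF inst] ca_outflow_eq_sum_colors[OF inst] .
  ultimately obtain t where t: "\<forall>c\<in>?K. \<forall>k\<in>?K. 0 \<le> t c k" "\<forall>c\<in>?K. t c c = (0::real)"
    "\<forall>c\<in>?K. (\<Sum>k\<in>?K. t c k) = ca_inflow_color I y v c"
    "\<forall>k\<in>?K. (\<Sum>c\<in>?K. t c k) = ca_outflow_color I y v k"
    using zero_diagonal_transport[of ?K "ca_inflow_color I y v" "ca_outflow_color I y v"]
      in_nonneg out_nonneg by auto
  have loss_row: "t (num_colors I + 1) k = 0" if "k \<in> ?K" for k
    using t(1,3) no_loss that sum_nonneg_eq_0_iff[of ?K "t (num_colors I + 1)"] by auto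
  have "(\<Sum>c\<in>colors I. t c k) = (\<Sum>c\<in>?K. t c k)" if "k \<in> ?K" for k
    using loss_row[OF that] by (simp add: colors_def)
  then show ?thesis using t by (intro exI[of _ t]) auto
qed

text \<open>The amount \<open>t i c k\<close> is spread over the arcs with tail \<open>i\<close> and
  label \<open>k\<close> in proportion to \<open>y\<close>. Summing over \<open>c\<close> recovers
  \<open>y\<close> by the column sums of \<open>t\<close>; summing over the arcs leaving
  \<open>(v, c)\<close> gives a row sum, which is the inflow.\<close>

lemma ex_ml_feasible:
  assumes inst: "cbpp_instance I" and y: "ca_feasible {0..} I z y"
  shows "\<exists>x. ml_feasible {0..} I z x"
proof -
  let ?K = "{1..num_colors I + 1}" and ?out = "ca_outflow_color I y"
  have nonneg: "0 \<le> y b" if "b \<in> ca_arcs I" for b using y that by (auto simp: ca_feasible_def)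
  have out_nonneg: "0 \<le> ?out v c" for v c
    unfolding ca_outflow_color_def using nonneg by (intro sum_nonneg) auto
  have y_le_out: "y (i, j, k) \<le> ?out i k" if "(i, j, k) \<in> ca_arcs I" for i j k
    unfolding ca_outflow_color_def using that nonneg
    by (intro member_le_sum) (auto simp: finite_ca_arcs)
  have cap: "0 < capacity I" using inst by (simp add: cbpp_instance_def)
  have col: "c \<in> ?K" if "c \<in> colors I" for c using that by (auto simp: colors_def)
  have "\<forall>v. \<exists>t. 1 \<le> v \<and> v < capacity I \<longrightarrow>
      (\<forall>c k. c \<in> ?K \<longrightarrow> k \<in> ?K \<longrightarrow> (0::real) \<le> t c k) \<and> (\<forall>c\<in>?K. t c c = 0) \<and>
      (\<forall>c\<in>?K. (\<Sum>k\<in>?K. t c k) = ca_inflow_color I y v c) \<and>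
      (\<forall>k\<in>?K. (\<Sum>c\<in>colors I. t c k) = ?out v k)"
    using ca_feasible_transport[OF inst y] by blast
  then obtain t where t: "\<And>v. 1 \<le> v \<and> v < capacity I \<longrightarrow>
      (\<forall>c k. c \<in> ?K \<longrightarrow> k \<in> ?K \<longrightarrow> (0::real) \<le> t v c k) \<and> (\<forall>c\<in>?K. t v c c = 0) \<and>
      (\<forall>c\<in>?K. (\<Sum>k\<in>?K. t v c k) = ca_inflow_color I y v c) \<and>
      (\<forall>k\<in>?K. (\<Sum>c\<in>colors I. t v c k) = ?out v k)"
    by metis
  have t_nonneg: "0 \<le> t v c k" and t_diag: "t v c c = 0"
    and t_row: "(\<Sum>k\<in>?K. t v c k) = ca_inflow_color I y v c"
    and t_col: "(\<Sum>c\<in>colors I. t v c k) = ?out v k"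
    if "1 \<le> v" "v < capacity I" "c \<in> ?K" "k \<in> ?K" for v c k
    using t[of v] that by auto
  have t_zero: "t v c k = 0" if v: "1 \<le> v" "v < capacity I" and c: "c \<in> colors I" and k: "k \<in> ?K"
    and 0: "?out v k = 0" for v c k
    using t_col[OF v col[OF c] k] t_nonneg[OF v _ k] col c 0
      sum_nonneg_eq_0_iff[of "colors I" "\<lambda>c. t v c k"] by (auto simp: colors_def)
  \<comment> \<open>If the outflow of some color is \<open>0\<close>, then so are the corresponding values of \<open>y\<close>
    and \<open>t\<close>, and the division by \<open>0\<close> below does no harm.\<close>
  define w where "w c b = (case b of (i, j, k) \<Rightarrow> y b * t i c k / ?out i k)" for c b
  \<comment> \<open>An arc with tail \<open>0\<close> has a single preimage, which carries all of
    its flow.\<close>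
  define x where "x a = (let b = collapse I a in if fst b = 0 then y b else w (snd (fst a)) b)" for a
  have x_nonneg: "0 \<le> x a" if "a \<in> ml_arcs I" for a
  proof -
    obtain i p j q where a: "a = ((i, p), (j, q))" by (metis surj_pair)
    obtain k where k: "collapse I a = (i, j, k)" by (simp add: a)
    have arc: "(i, j, k) \<in> ca_arcs I" and p: "i = 0 \<or> p \<in> colors I"
      using that ml_arcs_iff[OF inst, of i p j q] k by (auto simp: a split: if_splits)
    have "x a = (if i = 0 then y (i, j, k) else w p (i, j, k))"
      unfolding x_def k Let_def by (simp add: a)
    then show ?thesis
      using ca_arcsD[OF inst arc] p nonneg[OF arc] t_nonneg[of i p k] out_nonneg[of i k] col[of p]
      by (auto simp: w_def)
  qed
  \<comment> \<open>This reduces the source, sink and demand constraints for \<open>x\<close> to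
    those for \<open>y\<close>.\<close>
  have push: "y b = pushforward I x b" if arc: "b \<in> ca_arcs I" for b
  proof -
    obtain i j k where b: "b = (i, j, k)" by (metis surj_pair)
    note arc' = ca_arcsD[OF inst arc[unfolded b]]
    show ?thesis
    proof (cases "i = 0")
      case True
      then have "k \<in> colors I" using arc'(3,4) by (cases "k = num_colors I + 1") (auto simp: colors_def)
      then have "{a \<in> ml_arcs I. collapse I a = b} = {((0, 0), (j, k))}"
        using True arc by (auto simp: b ml_arcs_iff[OF inst] colors_def split: if_splits)
      then show ?thesis
        using True \<open>k \<in> colors I\<close> by (auto simp: pushforward_def x_def b colors_def)
    next
      case False
      then have i: "1 \<le> i" "i < capacity I" using arc' by auto
      let ?f = "\<lambda>c. ((i, c), (j, if k = num_colors I + 1 then c else k))"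
      have fibre: "{a \<in> ml_arcs I. collapse I a = b} = ?f ` (colors I - {k})"
        using False arc arc'(3)
        by (auto simp: b ml_arcs_iff[OF inst] colors_def image_iff split: if_splits)
      have coll: "collapse I (?f c) = b" if "c \<in> colors I - {k}" for c
        using that by (auto simp: b)
      have "pushforward I x b = (\<Sum>c\<in>colors I - {k}. x (?f c))"
        unfolding pushforward_def fibre by (subst sum.reindex) (auto simp: inj_on_def)
      also have "\<dots> = (\<Sum>c\<in>colors I - {k}. w c b)"
        using False by (intro sum.cong refl) (simp only: x_def coll Let_def, simp add: b)
      \<comment> \<open>Layer \<open>k\<close> has no outgoing arc with label \<open>k\<close>, but
        its share would be \<open>0\<close> by the zero diagonal.\<close>
      also have "\<dots> = (\<Sum>c\<in>colors I. w c b)"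
        using t_diag[OF i arc'(3) arc'(3)] by (intro sum.mono_neutral_left) (auto simp: colors_def w_def b)
      also have "\<dots> = y b * (\<Sum>c\<in>colors I. t i c k) / ?out i k"
        by (simp add: w_def b sum_distrib_left sum_divide_distrib)
      also have "\<dots> = y b * ?out i k / ?out i k"
        using t_col[OF i arc'(3) arc'(3)] by simp
      also have "\<dots> = y b"
        using y_le_out[of i j k] nonneg[OF arc] arc by (auto simp: b)
      finally show ?thesis by simp
    qed
  qed
  have flow: "ml_inflow I x (v, c) = ml_outflow I x (v, c)"
    if v: "1 \<le> v" "v < capacity I" and c: "c \<in> colors I" for v c
  proof -
    let ?A = "{a \<in> ml_arcs I. fst a = (v, c)}" and ?B = "{b \<in> ca_arcs I. fst b = v \<and> snd (snd b) \<noteq> c}"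
    have inj: "inj_on (collapse I) ?A"
      using c by (auto simp: inj_on_def ml_arcs_iff[OF inst] colors_def split: if_splits)
    have img: "collapse I ` ?A = ?B"
    proof (intro set_eqI iffI)
      fix b assume "b \<in> ?B"
      then obtain j k where b: "b = (v, j, k)" "(v, j, k) \<in> ca_arcs I" "k \<noteq> c" by (cases b) auto
      let ?a = "((v, c), (j, if k = num_colors I + 1 then c else k))"
      have "b = collapse I ?a" using b by auto
      moreover have "?a \<in> ?A"
        using b c v ca_arcsD(3)[OF inst b(2)] by (auto simp: ml_arcs_iff[OF inst] colors_def)
      ultimately show "b \<in> collapse I ` ?A" by (rule image_eqI)
    next
      fix b assume "b \<in> collapse I ` ?A"
      then show "b \<in> ?B"
        using c by (auto simp: ml_arcs_iff[OF inst] colors_def split: if_splits)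
    qed
    have "ml_outflow I x (v, c) = (\<Sum>a\<in>?A. w c (collapse I a))"
      unfolding ml_outflow_def x_def using v by (intro sum.cong) (auto simp: Let_def)
    also have "\<dots> = (\<Sum>b\<in>?B. w c b)"
      using sum.reindex[OF inj, of "w c"] by (simp add: img)
    \<comment> \<open>The zero diagonal again allows the missing arcs of color \<open>c\<close> to
      be added, so that the sum can be grouped by all labels.\<close>
    also have "\<dots> = (\<Sum>b\<in>{b \<in> ca_arcs I. fst b = v}. w c b)"
      using t_diag[OF v col[OF c] col[OF c]]
      by (intro sum.mono_neutral_left) (auto simp: finite_ca_arcs w_def)
    also have "\<dots> = (\<Sum>k\<in>?K. \<Sum>b\<in>{b \<in> {b \<in> ca_arcs I. fst b = v}. snd (snd b) = k}. w c b)"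
      using ca_arcsD(3)[OF inst] by (intro sum.group[symmetric]) (auto simp: finite_ca_arcs)
    also have "\<dots> = (\<Sum>k\<in>?K. t v c k)"
    proof (intro sum.cong refl)
      fix k assume k: "k \<in> ?K"
      have "(\<Sum>b\<in>{b \<in> {b \<in> ca_arcs I. fst b = v}. snd (snd b) = k}. w c b) =
          (\<Sum>b\<in>{b \<in> ca_arcs I. fst b = v \<and> snd (snd b) = k}. y b * (t v c k / ?out v k))"
        by (intro sum.cong) (auto simp: w_def)
      also have "\<dots> = ?out v k * (t v c k / ?out v k)"
        by (simp only: ca_outflow_color_def sum_distrib_right)
      also have "\<dots> = t v c k" using t_zero[OF v c k] by auto
      finally show "(\<Sum>b\<in>{b \<in> {b \<in> ca_arcs I. fst b = v}. snd (snd b) = k}. w c b) = t v c k" .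
    qed
    \<comment> \<open>The row sum is the inflow of color \<open>c\<close> in \<open>y\<close>; by
      \<open>push\<close> it is also the inflow of \<open>x\<close> into
      \<open>(v, c)\<close>.\<close>
    also have "\<dots> = ml_inflow I x (v, c)"
      using t_row[OF v col[OF c] col[OF c]] ca_inflow_color_pushforward[OF inst push v(2) c] by simp
    finally show ?thesis by simp
  qed
  have "ml_outflow I x (0, 0) = z"
    using ca_feasible_flow[OF y, of 0] ca_inflow_0[OF inst, of y]
      ca_outflow_0_pushforward[OF inst push] by simp
  moreover have "(\<Sum>q\<in>colors I. ml_inflow I x (capacity I, q)) = z"
    using ca_feasible_flow[OF y, of "capacity I"] cap ca_outflow_capacity[OF inst, of y]
      ca_inflow_pushforward[OF inst push, of "capacity I"] by simp
  ultimately have "ml_feasible {0..} I z x"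
    using y x_nonneg flow demand_pushforward[OF inst push]
    unfolding ml_feasible_def ca_feasible_def by auto
  then show ?thesis by blast
qed

theorem theorem3:
  fixes I :: cbpp
  assumes "cbpp_instance I"
  shows "ml_lp_bound I = ca_lp_bound I"
proof -
  \<comment> \<open>Both relaxations admit the same values \<open>z\<close>, so both infima are over
    the same set, possibly empty.\<close>
  have "(\<exists>x. ml_feasible {0..} I z x) \<longleftrightarrow> (\<exists>y. ca_feasible {0..} I z y)" for z
    using ca_feasible_pushforward[OF assms] ex_ml_feasible[OF assms] by blast
  then show ?thesis
    by (simp add: ml_lp_bound_def ca_lp_bound_def ml_value_def ca_value_def)
qed

end
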